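(* Let $(X,d)$ be a compact metric space, let $\mathbb{I}=\{S_1,\dots,S_N\}$ be an iterated function system of similarities on $X$ with similarity dimension $s$, and let $C\subseteq X$ be a non-empty compact set. Let $F_\emptyset$ be the homogeneous attractor of $\mathbb{I}$ and $F_C$ the inhomogeneous attractor of $\mathbb{I}$ with condensation $C$. Then $$\max\{\underline{\dim}_{\mathrm B}F_\emptyset,\ \underline{\dim}_{\mathrm B}C\}\le\underline{\dim}_{\mathrm B}F_C\le\overline{\dim}_{\mathrm B}F_C\le\max\{s,\ \overline{\dim}_{\mathrm B}C\},$$ and if $\mathbb{I}$ satisfies the strong open set condition (SOSC), then $$\max\{\underline{\dim}_{\mathrm B}F_\emptyset,\ \underline{\dim}_{\mathrm B}C\}\le\underline{\dim}_{\mathrm B}F_C\le\overline{\dim}_{\mathrm B}F_C\le\max\{\underline{\dim}_{\mathrm B}F_\emptyset,\ \overline{\dim}_{\mathrm B}C\}.$$ Consequently: (1) If the box dimension of $C$ exists and $\dim_{\mathrm B}C\ge s$, then $\underline{\dim}_{\mathrm B}F_C=\overline{\dim}_{\mathrm B}F_C=\dim_{\mathrm B}C$. (2) If the box dimension of $C$ exists and $\mathbb{I}$ satisfies the SOSC, then $\underline{\dim}_{\mathrm B}F_C=\overline{\dim}_{\mathrm B}F_C=\max\{\dim_{\mathrm B}F_\emptyset,\ \dim_{\mathrm B}C\}$. (3) If $\mathbb{I}$ satisfies the SOSC and $\overline{\dim}_{\mathrm B}C\le s$, then $\underline{\dim}_{\mathrm B}F_C=\overline{\dim}_{\mathrm B}F_C=s=\dim_{\mathrm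 B}F_\emptyset$. In each of the cases (1), (2), (3) one has $\underline{\dim}_{\mathrm B}F_C=\max\{\underline{\dim}_{\mathrm B}F_\emptyset,\ \underline{\dim}_{\mathrm B}C\}$.
   Context: An iterated function system (IFS) of similarities on $X$ is a finite collection of maps $S_i:X\to X$ such that for each $i$ there is a constant $\mathrm{Lip}(S_i)\in(0,1)$ with $d(S_i(x),S_i(y))=\mathrm{Lip}(S_i)\,d(x,y)$ for all $x,y\in X$. The homogeneous attractor $F_\emptyset$ is the unique non-empty compact set with $F_\emptyset=\bigcup_{i=1}^N S_i(F_\emptyset)$. The inhomogeneous attractor $F_C$ is the unique non-empty compact set with $F_C=\bigcup_{i=1}^N S_i(F_C)\cup C$. The similarity dimension $s$ is the unique solution of $\sum_{i=1}^N \mathrm{Lip}(S_i)^s=1$. The IFS satisfies the SOSC if there is a non-empty open set $U\subseteq X$ with $F_\emptyset\cap U\neq\emptyset$ and $\bigcup_{i=1}^N S_i(U)\subseteq U$ with the union disjoint. For a non-empty set $E\subseteq X$ and $\delta>0$, $N_\delta(E)$ is the minimum number of sets of diameter at most $\delta$ required to cover $E$; $\underline{\dim}_{\mathrm B}E$ and $\overline{\dim}_{\mathrm B}E$ are the $\liminf$ and $\limsup$, respectively, of $\frac{\log N_\delta(E)}{-\log\delta}$ as $\delta\to0$. If they coincide, the box dimension of $E$ is said to exist and the common value is denoted $\dim_{\mathrm B}E$. (For a homogeneous attractor $F_\emptyset$ of an IFS of similarities, the box dimension always exists.) *)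

theory Defs
  imports "HOL-Analysis.Analysis"
begin

text \<open>The ratio \<open>r i\<close> plays the role of \<open>Lip(S\<^sub>i)\<close>. It is carried as separate data because the maps
  determine it only when \<open>X\<close> has at least two points. The maps are constrained on \<open>X\<close> only.\<close>

definition similarity_ifs ::
    "'a::metric_space set \<Rightarrow> nat \<Rightarrow> (nat \<Rightarrow> 'a \<Rightarrow> 'a) \<Rightarrow> (nat \<Rightarrow> real) \<Rightarrow> bool" where
  "similarity_ifs X N S r \<longleftrightarrow> 1 \<le> N \<and>
     (\<forall>i\<in>{1..N}. S i ` X \<subseteq> X \<and> 0 < r i \<and> r i < 1 \<and>
        (\<forall>x\<in>X. \<forall>y\<in>X. dist (S i x) (S i y) = r i * dist x y))"

definition similarity_dim :: "nat \<Rightarrow> (nat \<Rightarrow> real) \<Rightarrow> real" where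
  "similarity_dim N r = (THE s. (\<Sum>i=1..N. r i powr s) = 1)"

definition homogeneous_attractor ::
    "'a::metric_space set \<Rightarrow> nat \<Rightarrow> (nat \<Rightarrow> 'a \<Rightarrow> 'a) \<Rightarrow> 'a set" where
  "homogeneous_attractor X N S =
     (THE F. F \<subseteq> X \<and> F \<noteq> {} \<and> compact F \<and> F = (\<Union>i\<in>{1..N}. S i ` F))"

definition inhomogeneous_attractor ::
    "'a::metric_space set \<Rightarrow> nat \<Rightarrow> (nat \<Rightarrow> 'a \<Rightarrow> 'a) \<Rightarrow> 'a set \<Rightarrow> 'a set" where
  "inhomogeneous_attractor X N S C =
     (THE F. F \<subseteq> X \<and> F \<noteq> {} \<and> compact F \<and> F = (\<Union>i\<in>{1..N}. S i ` F) \<union> C)"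

text \<open>Openness is relative to the ambient space \<open>X\<close>.\<close>

definition strong_open_set_condition ::
    "'a::metric_space set \<Rightarrow> nat \<Rightarrow> (nat \<Rightarrow> 'a \<Rightarrow> 'a) \<Rightarrow> bool" where
  "strong_open_set_condition X N S \<longleftrightarrow>
     (\<exists>U. openin (top_of_set X) U \<and> U \<noteq> {} \<and> homogeneous_attractor X N S \<inter> U \<noteq> {} \<and>
        (\<Union>i\<in>{1..N}. S i ` U) \<subseteq> U \<and> disjoint_family_on (\<lambda>i. S i ` U) {1..N})"

text \<open>Boundedness is required explicitly because \<^const>\<open>diameter\<close> is real-valued and has no meaning
  on unbounded sets. The covering sets need not lie in a given ambient set containing \<open>E\<close>; intersecting
  them with \<open>E\<close> shows that this does not affect the minimum. The minimum exists whenever \<open>E\<close> is totally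
  bounded and \<open>\<delta> > 0\<close>, in particular for compact \<open>E\<close>.\<close>

definition covering_number :: "real \<Rightarrow> 'a::metric_space set \<Rightarrow> nat" where
  "covering_number \<delta> E =
     (LEAST n. \<exists>\<U>. finite \<U> \<and> card \<U> = n \<and> E \<subseteq> \<Union>\<U> \<and> (\<forall>A\<in>\<U>. bounded A \<and> diameter A \<le> \<delta>))"

text \<open>The dimensions are extended reals, since a compact metric space may have infinite box dimension.\<close>

definition lower_box_dim :: "'a::metric_space set \<Rightarrow> ereal" where
  "lower_box_dim E =
     Liminf (at_right 0) (\<lambda>\<delta>::real. ereal (ln (real (covering_number \<delta> E)) / - ln \<delta>))"

definition upper_box_dim :: "'a::metric_space set \<Rightarrow> ereal" where
  "upper_box_dim E =
     Limsup (at_right 0) (\<lambda>\<delta>::real. ereal (ln (real (covering_number \<delta> E)) / - ln \<delta>))"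

definition box_dim_exists :: "'a::metric_space set \<Rightarrow> bool" where
  "box_dim_exists E \<longleftrightarrow> lower_box_dim E = upper_box_dim E"

text \<open>Unspecified unless \<open>box_dim_exists E\<close>.\<close>

definition box_dim :: "'a::metric_space set \<Rightarrow> ereal" where
  "box_dim E = (THE d. lower_box_dim E = d \<and> upper_box_dim E = d)"

end

theory Submission
  imports Defs
begin

text \<open>The lower bounds hold because the inhomogeneous attractor contains both the condensation set
  \<open>C\<close> and the homogeneous attractor, and the lower box dimension is monotone.

  For the upper bound, the fixed point equation \<open>F = (\<Union>i. S i ` F) \<union> C\<close> turns into the recursive
  inequality \<open>N\<^sub>\<delta>(F) \<le> (\<Sum>i. N\<^bsub>\<delta>/r i\<^esub>(F)) + N\<^sub>\<delta>(C)\<close> for covering numbers, since a cover of \<open>F\<close> at scale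
  \<open>\<delta> / r i\<close> is mapped by \<open>S i\<close> to a cover of \<open>S i ` F\<close> at scale \<open>\<delta>\<close>. If \<open>t\<close> exceeds both the similarity
  dimension \<open>s\<close> and the upper box dimension of \<open>C\<close>, then \<open>(\<Sum>i. r i powr t) < 1\<close> and
  \<open>N\<^sub>\<delta>(C) \<le> K * \<delta> powr - t\<close>, and induction from large to small scales shows that \<open>N\<^sub>\<delta>(F)\<close> is at most a
  constant times \<open>\<delta> powr - t\<close> (\<open>covering_number_power_law\<close>). The case \<open>C = {}\<close> bounds the upper box
  dimension of the homogeneous attractor by \<open>s\<close>.

  Under the strong open set condition the lower box dimension of the homogeneous attractor \<open>F\<^sub>0\<close> is
  at least \<open>s\<close> (\<open>similarity_dim_le_lower_box_dim\<close>). The open set \<open>U\<close> contains a small copy of \<open>F\<^sub>0\<close>; its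
  images under all compositions of \<open>k\<close> maps lie in pairwise disjoint images of \<open>U\<close>, so they are
  finitely many disjoint compact similar copies of \<open>F\<^sub>0\<close> inside \<open>F\<^sub>0\<close>, with a positive gap between them.
  Below that gap the recursive inequality holds in the opposite direction
  (\<open>le_lower_box_dim_of_disjoint_similar_copies\<close>). For \<open>t < s\<close> and \<open>k\<close> large the \<open>t\<close>-th powers of the
  ratios of these copies add up to at least \<open>1\<close>, which yields \<open>N\<^sub>\<delta>(F\<^sub>0) \<ge> c * \<delta> powr - t\<close>. Hence the box
  dimension of \<open>F\<^sub>0\<close> equals \<open>s\<close>, and the remaining claims follow by comparing the bounds.\<close>

section \<open>Covering numbers\<close>

text \<open>A bound on pairwise distances is equivalent to boundedness together with a bound on the diameter,
  and it passes directly to subsets, images and preimages.\<close>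

definition fine_cover :: "real \<Rightarrow> 'a::metric_space set \<Rightarrow> 'a set set \<Rightarrow> bool" where
  "fine_cover \<delta> E \<U> \<longleftrightarrow>
     finite \<U> \<and> E \<subseteq> \<Union>\<U> \<and> (\<forall>A\<in>\<U>. \<forall>x\<in>A. \<forall>y\<in>A. dist x y \<le> \<delta>)"

lemma bounded_diameter_le_iff:
  fixes A :: "'a::metric_space set"
  assumes "0 \<le> \<delta>"
  shows "bounded A \<and> diameter A \<le> \<delta> \<longleftrightarrow> (\<forall>x\<in>A. \<forall>y\<in>A. dist x y \<le> \<delta>)"
proof
  assume "bounded A \<and> diameter A \<le> \<delta>"
  then show "\<forall>x\<in>A. \<forall>y\<in>A. dist x y \<le> \<delta>"
    using diameter_bounded_bound by fastforce
next
  assume *: "\<forall>x\<in>A. \<forall>y\<in>A. dist x y \<le> \<delta>"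
  then have "bounded A"
    unfolding bounded_def by blast
  moreover have "diameter A \<le> \<delta>"
    using * assms by (auto simp: diameter_def intro!: cSUP_least)
  ultimately show "bounded A \<and> diameter A \<le> \<delta>" ..
qed

lemma covering_number_eq:
  assumes "0 \<le> \<delta>"
  shows "covering_number \<delta> E = (LEAST n. \<exists>\<U>. fine_cover \<delta> E \<U> \<and> card \<U> = n)"
proof -
  have "(\<exists>\<U>. finite \<U> \<and> card \<U> = n \<and> E \<subseteq> \<Union>\<U> \<and> (\<forall>A\<in>\<U>. bounded A \<and> diameter A \<le> \<delta>)) \<longleftrightarrow>
        (\<exists>\<U>. fine_cover \<delta> E \<U> \<and> card \<U> = n)" for n
    unfolding fine_cover_def bounded_diameter_le_iff[OF assms] by blast
  then show ?thesis
    unfolding covering_number_def by simp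
qed

lemma covering_number_le_card:
  assumes "0 \<le> \<delta>" "fine_cover \<delta> E \<U>"
  shows "covering_number \<delta> E \<le> card \<U>"
  unfolding covering_number_eq[OF assms(1)] using assms(2) by (auto intro: Least_le)

lemma fine_cover_exists:
  fixes X :: "'a::metric_space set"
  assumes "compact X" "E \<subseteq> X" "0 < \<delta>"
  shows "\<exists>\<U>. fine_cover \<delta> E \<U>"
proof -
  obtain D where D: "D \<subseteq> X" "finite D" "X \<subseteq> (\<Union>x\<in>D. ball x (\<delta>/2))"
    using compactE_image[OF assms(1), of X "\<lambda>x. ball x (\<delta>/2)"] \<open>0 < \<delta>\<close>
    by (metis (no_types, lifting) UN_iff centre_in_ball half_gt_zero open_ball subsetI)
  have "dist x y \<le> \<delta>" if "x \<in> ball z (\<delta>/2)" "y \<in> ball z (\<delta>/2)" for x y z :: 'a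
    using that dist_triangle_half_r[of z x \<delta> y] by (auto simp: mem_ball intro: less_imp_le)
  with D assms(2) have "fine_cover \<delta> E ((\<lambda>x. ball x (\<delta>/2)) ` D)"
    unfolding fine_cover_def by (auto simp del: mem_ball)
  then show ?thesis ..
qed

lemma fine_cover_attains_covering_number:
  assumes "compact X" "E \<subseteq> X" "0 < \<delta>"
  obtains \<U> where "fine_cover \<delta> E \<U>" "card \<U> = covering_number \<delta> E"
proof -
  have "\<exists>n \<U>. fine_cover \<delta> E \<U> \<and> card \<U> = n"
    using fine_cover_exists[OF assms] by blast
  from LeastI_ex[OF this] show ?thesis
    using that covering_number_eq[of \<delta> E] \<open>0 < \<delta>\<close> by auto
qed

lemma covering_number_mono:
  assumes "compact X" "F \<subseteq> X" "E \<subseteq> F" "0 < \<delta>" "\<delta> \<le> \<epsilon>"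
  shows "covering_number \<epsilon> E \<le> covering_number \<delta> F"
proof -
  obtain \<U> where \<U>: "fine_cover \<delta> F \<U>" "card \<U> = covering_number \<delta> F"
    using fine_cover_attains_covering_number[OF assms(1,2,4)] .
  have "fine_cover \<epsilon> E \<U>"
    using \<U>(1) assms(3,5) unfolding fine_cover_def by (meson order_trans)
  then show ?thesis
    using covering_number_le_card[of \<epsilon> E \<U>] \<U>(2) assms(4,5) by simp
qed

lemma covering_number_pos:
  assumes "compact X" "E \<subseteq> X" "E \<noteq> {}" "0 < \<delta>"
  shows "1 \<le> covering_number \<delta> E"
proof -
  obtain \<U> where \<U>: "fine_cover \<delta> E \<U>" "card \<U> = covering_number \<delta> E"
    using fine_cover_attains_covering_number[OF assms(1,2,4)] .
  then have "\<U> \<noteq> {}" "finite \<U>"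
    using assms(3) unfolding fine_cover_def by auto
  then show ?thesis
    using \<U>(2) by (metis One_nat_def Suc_leI card_gt_0_iff)
qed

lemma covering_number_empty:
  assumes "0 \<le> \<delta>"
  shows "covering_number \<delta> {} = 0"
  using covering_number_le_card[OF assms, of "{}" "{}"] by (simp add: fine_cover_def)

lemma covering_number_Un_le:
  assumes "compact X" "E \<subseteq> X" "F \<subseteq> X" "0 < \<delta>"
  shows "covering_number \<delta> (E \<union> F) \<le> covering_number \<delta> E + covering_number \<delta> F"
proof -
  obtain \<U> where \<U>: "fine_cover \<delta> E \<U>" "card \<U> = covering_number \<delta> E"
    using fine_cover_attains_covering_number[OF assms(1,2,4)] .
  obtain \<V> where \<V>: "fine_cover \<delta> F \<V>" "card \<V> = covering_number \<delta> F"
    using fine_cover_attains_covering_number[OF assms(1,3,4)] .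
  have "fine_cover \<delta> (E \<union> F) (\<U> \<union> \<V>)"
    using \<U>(1) \<V>(1) unfolding fine_cover_def by auto
  then have "covering_number \<delta> (E \<union> F) \<le> card (\<U> \<union> \<V>)"
    using covering_number_le_card assms(4) by (meson less_imp_le)
  also have "\<dots> \<le> card \<U> + card \<V>"
    by (rule card_Un_le)
  finally show ?thesis
    using \<U>(2) \<V>(2) by simp
qed

lemma covering_number_UN_le:
  assumes "compact X" "0 < \<delta>" "finite I" "\<And>i. i \<in> I \<Longrightarrow> E i \<subseteq> X"
  shows "covering_number \<delta> (\<Union>i\<in>I. E i) \<le> (\<Sum>i\<in>I. covering_number \<delta> (E i))"
  using assms(3,4)
proof (induction I rule: finite_induct)
  case empty
  then show ?case using covering_number_empty[of \<delta>] assms(2) by simp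
next
  case (insert i I)
  have "covering_number \<delta> (E i \<union> (\<Union>i\<in>I. E i))
      \<le> covering_number \<delta> (E i) + covering_number \<delta> (\<Union>i\<in>I. E i)"
    using insert.prems by (intro covering_number_Un_le[OF assms(1) _ _ assms(2)]) auto
  with insert show ?case by fastforce
qed

text \<open>Sets that are more than \<open>\<delta>\<close> apart do not share a member of a cover by sets of diameter at most
  \<open>\<delta>\<close>, so on such families subadditivity of the covering number can be reversed.\<close>

lemma sum_covering_number_le_UN_of_separated:
  fixes X :: "'a::metric_space set"
  assumes "compact X" "0 < \<delta>" "finite I" "\<And>i. i \<in> I \<Longrightarrow> E i \<subseteq> X"
    and sep: "\<And>i j x y. i \<in> I \<Longrightarrow> j \<in> I \<Longrightarrow> i \<noteq> j \<Longrightarrow> x \<in> E i \<Longrightarrow> y \<in> E j \<Longrightarrow> \<delta> < dist x y"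
  shows "(\<Sum>i\<in>I. covering_number \<delta> (E i)) \<le> covering_number \<delta> (\<Union>i\<in>I. E i)"
proof -
  have "(\<Union>i\<in>I. E i) \<subseteq> X"
    using assms(4) by blast
  then obtain \<U> where \<U>: "fine_cover \<delta> (\<Union>i\<in>I. E i) \<U>" "card \<U> = covering_number \<delta> (\<Union>i\<in>I. E i)"
    using fine_cover_attains_covering_number[OF assms(1) _ assms(2)] by blast
  define \<V> where "\<V> i = {A \<in> \<U>. A \<inter> E i \<noteq> {}}" for i
  have fin: "finite \<U>"
    using \<U>(1) unfolding fine_cover_def by blast
  have "fine_cover \<delta> (E i) (\<V> i)" if "i \<in> I" for i
    unfolding fine_cover_def
  proof (intro conjI)
    show "E i \<subseteq> \<Union> (\<V> i)"
    proof
      fix x assume x: "x \<in> E i"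
      then obtain A where "A \<in> \<U>" "x \<in> A"
        using \<U>(1) \<open>i \<in> I\<close> unfolding fine_cover_def by blast
      with x show "x \<in> \<Union> (\<V> i)"
        unfolding \<V>_def by blast
    qed
    show "\<forall>A\<in>\<V> i. \<forall>x\<in>A. \<forall>y\<in>A. dist x y \<le> \<delta>"
      using \<U>(1) unfolding fine_cover_def \<V>_def by blast
  qed (use fin in \<open>auto simp: \<V>_def\<close>)
  then have "(\<Sum>i\<in>I. covering_number \<delta> (E i)) \<le> (\<Sum>i\<in>I. card (\<V> i))"
    using assms(2) by (auto intro!: sum_mono covering_number_le_card)
  also have "\<dots> = card (\<Union>i\<in>I. \<V> i)"
  proof (rule card_UN_disjoint[symmetric])
    show "\<forall>i\<in>I. \<forall>j\<in>I. i \<noteq> j \<longrightarrow> \<V> i \<inter> \<V> j = {}"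
    proof (intro ballI impI equals0I)
      fix i j A assume ij: "i \<in> I" "j \<in> I" "i \<noteq> j" and A: "A \<in> \<V> i \<inter> \<V> j"
      then obtain x y where "x \<in> A" "x \<in> E i" "y \<in> A" "y \<in> E j" "A \<in> \<U>"
        unfolding \<V>_def by blast
      moreover from this have "dist x y \<le> \<delta>"
        using \<U>(1) unfolding fine_cover_def by blast
      ultimately show False
        using sep[OF ij, of x y] by simp
    qed
  qed (use assms(3) fin in \<open>auto simp: \<V>_def\<close>)
  also have "\<dots> \<le> card \<U>"
    using fin by (intro card_mono) (auto simp: \<V>_def)
  finally show ?thesis
    using \<U>(2) by simp
qed

definition similarity_on :: "'a::metric_space set \<Rightarrow> ('a \<Rightarrow> 'a) \<Rightarrow> real \<Rightarrow> bool" where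
  "similarity_on X f c \<longleftrightarrow>
     f ` X \<subseteq> X \<and> 0 < c \<and> (\<forall>x\<in>X. \<forall>y\<in>X. dist (f x) (f y) = c * dist x y)"

lemma similarity_on_inj: "similarity_on X f c \<Longrightarrow> inj_on f X"
  unfolding similarity_on_def inj_on_def
  by (metis dist_eq_0_iff mult_eq_0_iff order_less_irrefl)

lemma similarity_on_continuous:
  assumes "similarity_on X f c"
  shows "continuous_on X f"
proof -
  have "c-lipschitz_on X f"
    using assms unfolding similarity_on_def lipschitz_on_def by auto
  then show ?thesis
    by (rule lipschitz_on_continuous_on)
qed

lemma similarity_on_compact_image:
  "similarity_on X f c \<Longrightarrow> E \<subseteq> X \<Longrightarrow> compact E \<Longrightarrow> compact (f ` E)"
  by (meson compact_continuous_image continuous_on_subset similarity_on_continuous)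

text \<open>Covers can be transported in both directions along a similarity: forwards by taking images,
  backwards by taking preimages.\<close>

lemma covering_number_similarity_image:
  assumes "compact X" and f: "similarity_on X f c" and E: "E \<subseteq> X" and "0 < \<delta>"
  shows "covering_number \<delta> (f ` E) = covering_number (\<delta> / c) E"
proof (rule antisym)
  have dist_f: "dist (f x) (f y) = c * dist x y" if "x \<in> E" "y \<in> E" for x y
    using f E that unfolding similarity_on_def by auto
  have c: "0 < c"
    using f unfolding similarity_on_def by simp
  have pos: "0 < \<delta> / c"
    using c \<open>0 < \<delta>\<close> by simp
  have "f ` E \<subseteq> X"
    using f E unfolding similarity_on_def by blast
  then obtain \<V> where \<V>: "fine_cover \<delta> (f ` E) \<V>" "card \<V> = covering_number \<delta> (f ` E)"
    using fine_cover_attains_covering_number[OF assms(1) _ \<open>0 < \<delta>\<close>] by blast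
  obtain \<U> where \<U>: "fine_cover (\<delta> / c) E \<U>" "card \<U> = covering_number (\<delta> / c) E"
    using fine_cover_attains_covering_number[OF assms(1) E pos] .

  have "fine_cover \<delta> (f ` E) ((\<lambda>A. f ` (A \<inter> E)) ` \<U>)"
    unfolding fine_cover_def
  proof (intro conjI ballI)
    show "finite ((\<lambda>A. f ` (A \<inter> E)) ` \<U>)"
      using \<U>(1) unfolding fine_cover_def by blast
    show "f ` E \<subseteq> \<Union> ((\<lambda>A. f ` (A \<inter> E)) ` \<U>)"
      using \<U>(1) unfolding fine_cover_def by blast
    fix B u v assume "B \<in> (\<lambda>A. f ` (A \<inter> E)) ` \<U>" "u \<in> B" "v \<in> B"
    then obtain A x y where "A \<in> \<U>" "x \<in> A" "y \<in> A" "x \<in> E" "y \<in> E" "u = f x" "v = f y"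
      by blast
    moreover from this have "dist x y \<le> \<delta> / c"
      using \<U>(1) unfolding fine_cover_def by blast
    ultimately show "dist u v \<le> \<delta>"
      using c by (simp add: dist_f field_simps)
  qed
  then have "covering_number \<delta> (f ` E) \<le> card ((\<lambda>A. f ` (A \<inter> E)) ` \<U>)"
    using covering_number_le_card \<open>0 < \<delta>\<close> by (meson less_imp_le)
  also have "\<dots> \<le> card \<U>"
    using \<U>(1) by (intro card_image_le) (simp add: fine_cover_def)
  finally show "covering_number \<delta> (f ` E) \<le> covering_number (\<delta> / c) E"
    using \<U>(2) by simp

  have "fine_cover (\<delta> / c) E ((\<lambda>B. f -` B \<inter> E) ` \<V>)"
    unfolding fine_cover_def
  proof (intro conjI ballI)
    show "finite ((\<lambda>B. f -` B \<inter> E) ` \<V>)"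
      using \<V>(1) unfolding fine_cover_def by blast
    show "E \<subseteq> \<Union> ((\<lambda>B. f -` B \<inter> E) ` \<V>)"
      using \<V>(1) unfolding fine_cover_def by blast
    fix A x y assume "A \<in> (\<lambda>B. f -` B \<inter> E) ` \<V>" "x \<in> A" "y \<in> A"
    then obtain B where "B \<in> \<V>" "f x \<in> B" "f y \<in> B" and xy: "x \<in> E" "y \<in> E"
      by blast
    then have "dist (f x) (f y) \<le> \<delta>"
      using \<V>(1) unfolding fine_cover_def by blast
    then show "dist x y \<le> \<delta> / c"
      using c dist_f[OF xy] by (simp add: field_simps)
  qed
  then have "covering_number (\<delta> / c) E \<le> card ((\<lambda>B. f -` B \<inter> E) ` \<V>)"
    using covering_number_le_card pos by (meson less_imp_le)
  also have "\<dots> \<le> card \<V>"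
    using \<V>(1) by (intro card_image_le) (simp add: fine_cover_def)
  finally show "covering_number (\<delta> / c) E \<le> covering_number \<delta> (f ` E)"
    using \<V>(2) by simp
qed

section \<open>Box dimension and power laws\<close>

lemma eventually_scale: "0 < a \<Longrightarrow> eventually (\<lambda>\<delta>::real. 0 < \<delta> \<and> \<delta> < a) (at_right 0)"
  using eventually_at_right_real[of 0 a] by simp

lemma lower_le_upper_box_dim: "lower_box_dim E \<le> upper_box_dim E"
  unfolding lower_box_dim_def upper_box_dim_def
  by (rule Liminf_le_Limsup) simp

lemma lower_box_dim_nonneg:
  assumes "compact X" "E \<subseteq> X" "E \<noteq> {}"
  shows "0 \<le> lower_box_dim E"
  unfolding lower_box_dim_def
proof (rule Liminf_bounded)
  show "eventually (\<lambda>\<delta>. 0 \<le> ereal (ln (real (covering_number \<delta> E)) / - ln \<delta>)) (at_right 0)"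
    using eventually_scale[OF zero_less_one]
  proof eventually_elim
    case (elim \<delta>)
    then have "1 \<le> covering_number \<delta> E"
      using covering_number_pos[OF assms] by simp
    then show ?case
      using elim by (simp add: divide_nonneg_neg)
  qed
qed

lemma eventually_log_quotient_mono:
  assumes "compact X" "F \<subseteq> X" "E \<subseteq> F" "E \<noteq> {}"
  shows "eventually (\<lambda>\<delta>. ereal (ln (real (covering_number \<delta> E)) / - ln \<delta>)
           \<le> ereal (ln (real (covering_number \<delta> F)) / - ln \<delta>)) (at_right 0)"
  using eventually_scale[OF zero_less_one]
proof eventually_elim
  case (elim \<delta>)
  have "1 \<le> covering_number \<delta> E"
    using covering_number_pos[OF assms(1) _ assms(4)] assms(2,3) elim by auto
  moreover have "covering_number \<delta> E \<le> covering_number \<delta> F"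
    using covering_number_mono[OF assms(1,2,3)] elim by auto
  ultimately have "ln (real (covering_number \<delta> E)) \<le> ln (real (covering_number \<delta> F))"
    by (subst ln_le_cancel_iff) auto
  then show ?case
    using elim by (simp add: divide_right_mono_neg)
qed

lemma lower_box_dim_mono:
  assumes "compact X" "F \<subseteq> X" "E \<subseteq> F" "E \<noteq> {}"
  shows "lower_box_dim E \<le> lower_box_dim F"
  unfolding lower_box_dim_def by (rule Liminf_mono[OF eventually_log_quotient_mono[OF assms]])

lemma log_quotient_tendsto:
  "((\<lambda>\<delta>::real. ereal (t + a / - ln \<delta>)) \<longlongrightarrow> ereal t) (at_right 0)"
proof -
  have "LIM \<delta> at_right 0. - ln (\<delta>::real) :> at_top"
    using ln_at_0 by (simp add: filterlim_uminus_at_top_at_bot filterlim_uminus_at_bot)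
  then have "((\<lambda>\<delta>::real. a / - ln \<delta>) \<longlongrightarrow> 0) (at_right 0)"
    by (rule real_tendsto_divide_at_top[OF tendsto_const])
  from tendsto_add[OF tendsto_const[of t] this] show ?thesis
    by simp
qed

lemma upper_box_dim_le_of_power_law:
  assumes "compact X" "E \<subseteq> X" "E \<noteq> {}" "0 < b"
    and bound: "\<And>\<delta>. 0 < \<delta> \<Longrightarrow> \<delta> \<le> b \<Longrightarrow> real (covering_number \<delta> E) \<le> M * \<delta> powr - t"
  shows "upper_box_dim E \<le> ereal t"
proof -
  have b: "0 < min b 1"
    using \<open>0 < b\<close> by simp
  have "eventually (\<lambda>\<delta>. ereal (ln (real (covering_number \<delta> E)) / - ln \<delta>)
          \<le> ereal (t + ln M / - ln \<delta>)) (at_right 0)"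
    using eventually_scale[OF b]
  proof eventually_elim
    case (elim \<delta>)
    then have N: "1 \<le> covering_number \<delta> E"
      using covering_number_pos[OF assms(1-3)] by simp
    then have "1 \<le> M * \<delta> powr - t"
      using bound[of \<delta>] elim by simp
    then have M: "0 < M"
      by (smt (verit) mult_nonpos_nonneg powr_ge_zero)
    have "ln (real (covering_number \<delta> E)) \<le> ln (M * \<delta> powr - t)"
      using N bound[of \<delta>] elim by (subst ln_le_cancel_iff) (auto simp: M)
    also have "\<dots> = ln M + t * - ln \<delta>"
      using M elim by (simp add: ln_mult ln_powr)
    finally have "ln (real (covering_number \<delta> E)) / - ln \<delta> \<le> (ln M + t * - ln \<delta>) / - ln \<delta>"
      using elim by (intro divide_right_mono) auto
    also have "\<dots> = t + ln M / - ln \<delta>"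
      using elim by (simp add: field_simps)
    finally show ?case by simp
  qed
  then have "upper_box_dim E \<le> Limsup (at_right 0) (\<lambda>\<delta>::real. ereal (t + ln M / - ln \<delta>))"
    unfolding upper_box_dim_def by (rule Limsup_mono)
  also have "\<dots> = ereal t"
    by (rule lim_imp_Limsup[OF _ log_quotient_tendsto]) simp
  finally show ?thesis .
qed

lemma le_lower_box_dim_of_power_law:
  assumes "0 < c" "0 < b"
    and bound: "\<And>\<delta>. 0 < \<delta> \<Longrightarrow> \<delta> \<le> b \<Longrightarrow> c * \<delta> powr - t \<le> real (covering_number \<delta> E)"
  shows "ereal t \<le> lower_box_dim E"
proof -
  have b: "0 < min b 1"
    using \<open>0 < b\<close> by simp
  have "eventually (\<lambda>\<delta>. ereal (t + ln c / - ln \<delta>)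
          \<le> ereal (ln (real (covering_number \<delta> E)) / - ln \<delta>)) (at_right 0)"
    using eventually_scale[OF b]
  proof eventually_elim
    case (elim \<delta>)
    have pos: "0 < c * \<delta> powr - t"
      using elim \<open>0 < c\<close> by simp
    have "t + ln c / - ln \<delta> = (ln c + t * - ln \<delta>) / - ln \<delta>"
      using elim by (simp add: field_simps)
    also have "ln c + t * - ln \<delta> = ln (c * \<delta> powr - t)"
      using \<open>0 < c\<close> elim by (simp add: ln_mult ln_powr)
    also have "\<dots> / - ln \<delta> \<le> ln (real (covering_number \<delta> E)) / - ln \<delta>"
    proof (rule divide_right_mono)
      show "ln (c * \<delta> powr - t) \<le> ln (real (covering_number \<delta> E))"
        using pos bound[of \<delta>] elim by (subst ln_le_cancel_iff) auto
    qed (use elim in auto)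
    finally show ?case by simp
  qed
  then have "Liminf (at_right 0) (\<lambda>\<delta>::real. ereal (t + ln c / - ln \<delta>)) \<le> lower_box_dim E"
    unfolding lower_box_dim_def by (rule Liminf_mono)
  moreover have "Liminf (at_right 0) (\<lambda>\<delta>::real. ereal (t + ln c / - ln \<delta>)) = ereal t"
    by (rule lim_imp_Liminf[OF _ log_quotient_tendsto]) simp
  ultimately show ?thesis
    by simp
qed

text \<open>The definition of the upper box dimension controls only small scales. For the scales up to \<open>1\<close>
  that remain, the covering number is bounded while \<open>\<delta> powr - t\<close> is at least \<open>1\<close>, so enlarging the
  constant suffices.\<close>

lemma power_law_of_upper_box_dim_less:
  assumes "compact X" "E \<subseteq> X" "E \<noteq> {}" "upper_box_dim E < ereal t" "0 \<le> t"
  obtains K where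
    "\<And>\<delta>. 0 < \<delta> \<Longrightarrow> \<delta> \<le> 1 \<Longrightarrow> real (covering_number \<delta> E) \<le> K * \<delta> powr - t"
proof -
  have "eventually (\<lambda>\<delta>. ereal (ln (real (covering_number \<delta> E)) / - ln \<delta>) < ereal t) (at_right 0)"
    using assms(4) unfolding upper_box_dim_def by (rule Limsup_lessD)
  then obtain a where a: "0 < a"
    "\<And>\<delta>. 0 < \<delta> \<Longrightarrow> \<delta> < a \<Longrightarrow> ln (real (covering_number \<delta> E)) / - ln \<delta> < t"
    unfolding eventually_at_right_field by auto
  define b where "b = min a 1 / 2"
  have b: "0 < b" "b < a" "b < 1"
    using a(1) unfolding b_def by auto
  define K where "K = max 1 (real (covering_number b E))"
  have "real (covering_number \<delta> E) \<le> K * \<delta> powr - t" if \<delta>: "0 < \<delta>" "\<delta> \<le> 1" for \<delta>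
  proof (cases "\<delta> < b")
    case True
    have N: "1 \<le> covering_number \<delta> E"
      using covering_number_pos[OF assms(1-3) \<delta>(1)] .
    have "ln (real (covering_number \<delta> E)) < t * - ln \<delta>"
      using a(2)[of \<delta>] \<delta>(1) True b by (simp add: field_simps)
    also have "\<dots> = ln (\<delta> powr - t)"
      using \<delta> by (simp add: ln_powr)
    finally have "real (covering_number \<delta> E) < \<delta> powr - t"
      using N \<delta> by (subst (asm) ln_less_cancel_iff) auto
    also have "\<dots> \<le> K * \<delta> powr - t"
      using mult_right_mono[of 1 K "\<delta> powr - t"] by (simp add: K_def)
    finally show ?thesis by simp
  next
    case False
    then have "real (covering_number \<delta> E) \<le> K * 1"
      using covering_number_mono[OF assms(1,2) order_refl b(1), of \<delta>] by (simp add: K_def)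
    also have "1 \<le> \<delta> powr - t"
      using powr_mono2'[of "- t" \<delta> 1] \<delta> assms(5) by simp
    then have "K * 1 \<le> K * \<delta> powr - t"
      by (intro mult_left_mono) (auto simp: K_def)
    finally show ?thesis .
  qed
  then show ?thesis
    using that by blast
qed

text \<open>Power laws for self-similar sets come from recursive inequalities that relate the scale \<open>\<delta>\<close> to
  the scales \<open>\<delta> / r\<close> with \<open>r \<le> q < 1\<close>. Each such step enlarges the scale by a definite factor, so every
  positive scale is settled after finitely many steps.\<close>

lemma scale_induct:
  fixes P :: "real \<Rightarrow> bool"
  assumes q: "0 < q" "q < 1" and a: "0 < a"
    and base: "\<And>\<delta>. a \<le> \<delta> \<Longrightarrow> \<delta> \<le> b \<Longrightarrow> P \<delta>"
    and step: "\<And>\<delta>. 0 < \<delta> \<Longrightarrow> \<delta> < a \<Longrightarrow> (\<And>\<epsilon>. \<delta> / q \<le> \<epsilon> \<Longrightarrow> \<epsilon> \<le> b \<Longrightarrow> P \<epsilon>) \<Longrightarrow> P \<delta>"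
    and \<delta>: "0 < \<delta>" "\<delta> \<le> b"
  shows "P \<delta>"
proof -
  have *: "P \<delta>" if "a * q ^ n \<le> \<delta>" "\<delta> \<le> b" for n \<delta>
    using that
  proof (induction n arbitrary: \<delta>)
    case 0
    then show ?case using base by simp
  next
    case (Suc n)
    have pos: "0 < \<delta>"
      using Suc.prems(1) a q by (smt (verit) mult_pos_pos zero_less_power)
    show ?case
    proof (cases "a \<le> \<delta>")
      case True
      then show ?thesis using base Suc.prems by blast
    next
      case False
      have "a * q ^ n \<le> \<delta> / q"
        using Suc.prems(1) q by (simp add: field_simps)
      with Suc.IH have "P \<epsilon>" if "\<delta> / q \<le> \<epsilon>" "\<epsilon> \<le> b" for \<epsilon>
        using that by (meson order_trans)
      then show ?thesis
        using step[OF pos] False by simp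
    qed
  qed
  obtain n where "q ^ n < \<delta> / a"
    using real_arch_pow_inv[of "\<delta> / a" q] q a \<delta> by auto
  then have "a * q ^ n \<le> \<delta>"
    using a by (simp add: field_simps)
  then show ?thesis
    using * \<delta>(2) by blast
qed

section \<open>Disjoint similar copies force dimension\<close>

lemma finite_ratio_bounds:
  fixes \<rho> :: "'i \<Rightarrow> real"
  assumes "finite J" "\<And>v. v \<in> J \<Longrightarrow> 0 < \<rho> v \<and> \<rho> v < 1"
  obtains p q where "0 < p" "0 < q" "q < 1" "\<And>v. v \<in> J \<Longrightarrow> p \<le> \<rho> v \<and> \<rho> v \<le> q"
proof
  show "0 < Min (insert (1/2) (\<rho> ` J))" "Max (insert (1/2) (\<rho> ` J)) < 1"
    using assms by auto
  show "0 < Max (insert (1/2) (\<rho> ` J))"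
    using assms(1) by (subst Max_gr_iff) auto
qed (use assms(1) in auto)

lemma compact_disjoint_gap:
  fixes A B :: "'a::metric_space set"
  assumes "compact A" "compact B" "A \<inter> B = {}"
  shows "\<exists>\<epsilon>>0. \<forall>x\<in>A. \<forall>y\<in>B. \<epsilon> \<le> dist x y"
proof (cases "A = {} \<or> B = {}")
  case True
  then show ?thesis by (auto intro: exI[of _ 1])
next
  case False
  then obtain x where x: "x \<in> A" "\<forall>z\<in>A. infdist x B \<le> infdist z B"
    using continuous_attains_inf[OF assms(1) _ continuous_on_infdist[OF continuous_on_id]] by blast
  have "0 < infdist x B"
    using x(1) assms False in_closed_iff_infdist_zero[of B x] infdist_nonneg[of x B]
    by (force simp: compact_imp_closed)
  moreover have "\<forall>z\<in>A. \<forall>y\<in>B. infdist x B \<le> dist z y"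
    using x(2) infdist_le by (metis order_trans)
  ultimately show ?thesis by blast
qed

lemma finite_compact_disjoint_gap:
  fixes E :: "'i \<Rightarrow> 'a::metric_space set"
  assumes "finite J" "\<And>i. i \<in> J \<Longrightarrow> compact (E i)" "disjoint_family_on E J"
  obtains \<epsilon> where "0 < \<epsilon>"
    "\<And>i j x y. i \<in> J \<Longrightarrow> j \<in> J \<Longrightarrow> i \<noteq> j \<Longrightarrow> x \<in> E i \<Longrightarrow> y \<in> E j \<Longrightarrow> \<epsilon> \<le> dist x y"
proof -
  have "eventually (\<lambda>\<epsilon>. i \<noteq> j \<longrightarrow> (\<forall>x\<in>E i. \<forall>y\<in>E j. \<epsilon> \<le> dist x y)) (at_right 0)"
    if ij: "i \<in> J" "j \<in> J" for i j
  proof (cases "i = j")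
    case False
    then have "E i \<inter> E j = {}"
      using assms(3) ij unfolding disjoint_family_on_def by blast
    then obtain \<epsilon> where \<epsilon>: "0 < \<epsilon>" "\<forall>x\<in>E i. \<forall>y\<in>E j. \<epsilon> \<le> dist x y"
      using compact_disjoint_gap[OF assms(2)[OF ij(1)] assms(2)[OF ij(2)]] by blast
    show ?thesis
      using eventually_scale[OF \<epsilon>(1)] by (rule eventually_mono) (use \<epsilon>(2) in force)
  qed simp
  then have "eventually (\<lambda>\<epsilon>. \<forall>i\<in>J. \<forall>j\<in>J. i \<noteq> j \<longrightarrow> (\<forall>x\<in>E i. \<forall>y\<in>E j. \<epsilon> \<le> dist x y))
      (at_right (0::real))"
    using assms(1) by (intro eventually_ball_finite ballI) auto
  then have "eventually (\<lambda>\<epsilon>. 0 < \<epsilon> \<and>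
      (\<forall>i\<in>J. \<forall>j\<in>J. i \<noteq> j \<longrightarrow> (\<forall>x\<in>E i. \<forall>y\<in>E j. \<epsilon> \<le> dist x y))) (at_right (0::real))"
    using eventually_scale[OF zero_less_one] by eventually_elim auto
  from eventually_happens[OF this] obtain \<epsilon> :: real where "0 < \<epsilon>"
      "\<forall>i\<in>J. \<forall>j\<in>J. i \<noteq> j \<longrightarrow> (\<forall>x\<in>E i. \<forall>y\<in>E j. \<epsilon> \<le> dist x y)"
    by auto
  then show ?thesis
    by (intro that[of \<epsilon>]) blast+
qed

text \<open>Below the gap between the copies no covering set serves two of them, so
  \<open>N\<^sub>\<delta>(F) \<ge> (\<Sum>v. N\<^bsub>\<delta>/\<rho> v\<^esub>(F))\<close>. A lower bound \<open>c * \<delta> powr - t\<close> reproduces itself under this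
  recursion precisely because \<open>(\<Sum>v. \<rho> v powr t) \<ge> 1\<close>.\<close>

lemma le_lower_box_dim_of_disjoint_similar_copies:
  fixes X F :: "'a::metric_space set" and \<rho> :: "'i \<Rightarrow> real"
  assumes X: "compact X" and F: "F \<subseteq> X" "compact F" "F \<noteq> {}" and J: "finite J"
    and T: "\<And>v. v \<in> J \<Longrightarrow> similarity_on X (T v) (\<rho> v) \<and> \<rho> v < 1 \<and> T v ` F \<subseteq> F"
    and disj: "disjoint_family_on (\<lambda>v. T v ` F) J"
    and t: "0 \<le> t" "1 \<le> (\<Sum>v\<in>J. \<rho> v powr t)"
  shows "ereal t \<le> lower_box_dim F"
proof -
  have \<rho>: "0 < \<rho> v \<and> \<rho> v < 1" if "v \<in> J" for v
    using T[OF that] unfolding similarity_on_def by blast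
  obtain p q where pq: "0 < p" "0 < q" "q < 1" "\<And>v. v \<in> J \<Longrightarrow> p \<le> \<rho> v \<and> \<rho> v \<le> q"
    using finite_ratio_bounds[OF J, of \<rho>] \<rho> by metis
  have "compact (T v ` F)" if "v \<in> J" for v
    using T[OF that] F similarity_on_compact_image by blast
  then obtain \<epsilon> where \<epsilon>: "0 < \<epsilon>" and gap: "\<And>u v x y. u \<in> J \<Longrightarrow> v \<in> J \<Longrightarrow> u \<noteq> v \<Longrightarrow>
      x \<in> T u ` F \<Longrightarrow> y \<in> T v ` F \<Longrightarrow> \<epsilon> \<le> dist x y"
    using finite_compact_disjoint_gap[OF J, of "\<lambda>v. T v ` F"] disj by blast
  have "J \<noteq> {}"
    using t(2) by auto
  then have "p < 1"
    using pq by fastforce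
  \<comment> \<open>With this constant the claimed lower bound is at most \<open>1\<close> at every scale from \<open>\<epsilon>\<close> upwards.\<close>
  define c where "c = \<epsilon> powr t"
  have c: "0 < c"
    using \<epsilon> unfolding c_def by simp
  have bound: "c * \<delta> powr - t \<le> real (covering_number \<delta> F)" if "0 < \<delta>" "\<delta> \<le> \<epsilon> / p" for \<delta>
    using pq(2,3) \<epsilon> _ _ that
  proof (rule scale_induct)
    fix \<delta> assume "\<epsilon> \<le> \<delta>" "\<delta> \<le> \<epsilon> / p"
    then have "c * \<delta> powr - t \<le> c * \<epsilon> powr - t"
      using \<epsilon> t(1) c by (intro mult_left_mono powr_mono2') auto
    also have "\<dots> = 1"
      using \<epsilon> unfolding c_def by (simp add: powr_minus)
    also have "1 \<le> real (covering_number \<delta> F)"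
      using covering_number_pos[OF X F(1,3), of \<delta>] \<open>\<epsilon> \<le> \<delta>\<close> \<epsilon> by simp
    finally show "c * \<delta> powr - t \<le> real (covering_number \<delta> F)" .
  next
    fix \<delta> assume \<delta>: "0 < \<delta>" "\<delta> < \<epsilon>"
      and IH: "\<And>\<eta>. \<delta> / q \<le> \<eta> \<Longrightarrow> \<eta> \<le> \<epsilon> / p \<Longrightarrow> c * \<eta> powr - t \<le> real (covering_number \<eta> F)"
    have "c * \<delta> powr - t \<le> c * \<delta> powr - t * (\<Sum>v\<in>J. \<rho> v powr t)"
      using t(2) c mult_left_mono[of 1 _ "c * \<delta> powr - t"] by simp
    also have "\<dots> = (\<Sum>v\<in>J. c * (\<delta> / \<rho> v) powr - t)"
      unfolding sum_distrib_left
      using \<rho> \<delta> by (intro sum.cong) (auto simp: powr_divide powr_minus field_simps)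
    also have "\<dots> \<le> (\<Sum>v\<in>J. real (covering_number (\<delta> / \<rho> v) F))"
    proof (rule sum_mono, rule IH)
      fix v assume v: "v \<in> J"
      show "\<delta> / q \<le> \<delta> / \<rho> v"
        using \<rho>[OF v] pq(4)[OF v] \<delta> by (intro divide_left_mono) auto
      show "\<delta> / \<rho> v \<le> \<epsilon> / p"
        using pq(1) pq(4)[OF v] \<delta> by (intro frac_le) auto
    qed
    also have "\<dots> = real (\<Sum>v\<in>J. covering_number \<delta> (T v ` F))"
      unfolding of_nat_sum
    proof (intro sum.cong refl arg_cong[of _ _ real])
      show "covering_number (\<delta> / \<rho> v) F = covering_number \<delta> (T v ` F)" if "v \<in> J" for v
        using T[OF that] covering_number_similarity_image[OF X _ F(1) \<delta>(1)] by metis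
    qed
    also have "\<dots> \<le> real (covering_number \<delta> (\<Union>v\<in>J. T v ` F))"
      unfolding of_nat_le_iff
    proof (rule sum_covering_number_le_UN_of_separated[OF X \<delta>(1) J])
      show "T v ` F \<subseteq> X" if "v \<in> J" for v
        using T[OF that] F(1) by blast
      show "\<delta> < dist x y" if "u \<in> J" "v \<in> J" "u \<noteq> v" "x \<in> T u ` F" "y \<in> T v ` F" for u v x y
        using gap[OF that] \<delta>(2) by simp
    qed
    also have "\<dots> \<le> real (covering_number \<delta> F)"
      unfolding of_nat_le_iff
      by (rule covering_number_mono[OF X F(1) _ \<delta>(1) order_refl]) (use T in blast)
    finally show "c * \<delta> powr - t \<le> real (covering_number \<delta> F)" .
  qed
  show ?thesis
    using bound c \<epsilon> pq(1) by (intro le_lower_box_dim_of_power_law[of c "\<epsilon> / p"]) auto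
qed

section \<open>Attractors of systems of similarities\<close>

locale similarity_system =
  fixes X :: "'a::metric_space set" and N :: nat and S :: "nat \<Rightarrow> 'a \<Rightarrow> 'a" and r :: "nat \<Rightarrow> real"
  assumes compact_X: "compact X" and X_nonempty: "X \<noteq> {}" and ifs: "similarity_ifs X N S r"
begin

lemma N_pos: "1 \<le> N"
  using ifs unfolding similarity_ifs_def by blast

lemma ratio: "i \<in> {1..N} \<Longrightarrow> 0 < r i \<and> r i < 1"
  using ifs unfolding similarity_ifs_def by blast

lemma similarity: "i \<in> {1..N} \<Longrightarrow> similarity_on X (S i) (r i)"
  using ifs unfolding similarity_ifs_def similarity_on_def by blast

lemma maps_into: "i \<in> {1..N} \<Longrightarrow> E \<subseteq> X \<Longrightarrow> S i ` E \<subseteq> X"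
  using similarity unfolding similarity_on_def by blast

definition hutchinson :: "'a set \<Rightarrow> 'a set \<Rightarrow> 'a set" where
  "hutchinson C F = (\<Union>i\<in>{1..N}. S i ` F) \<union> C"

lemma hutchinson_mono: "E \<subseteq> F \<Longrightarrow> hutchinson C E \<subseteq> hutchinson C F"
  unfolding hutchinson_def by blast

lemma hutchinson_subset: "F \<subseteq> X \<Longrightarrow> C \<subseteq> X \<Longrightarrow> hutchinson C F \<subseteq> X"
  unfolding hutchinson_def using maps_into by blast

lemma hutchinson_compact:
  "F \<subseteq> X \<Longrightarrow> compact F \<Longrightarrow> compact C \<Longrightarrow> compact (hutchinson C F)"
  unfolding hutchinson_def
  by (intro compact_Un compact_UN similarity_on_compact_image[OF similarity]) auto

text \<open>A point of \<open>F\<close> at maximal distance from \<open>G\<close> is, unless it lies in \<open>C \<subseteq> G\<close>, the image \<open>S i y\<close> of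
  some \<open>y \<in> F\<close>. Since \<open>S i\<close> maps \<open>G\<close> into \<open>G\<close>, the maximal distance is at most \<open>r i\<close> times itself, hence
  zero. This comparison gives uniqueness of the attractors as well as the inclusion of the homogeneous
  attractor in the inhomogeneous one.\<close>

lemma hutchinson_comparison:
  assumes F: "F \<subseteq> X" "compact F" "F \<subseteq> hutchinson C F"
    and G: "G \<subseteq> X" "compact G" "G \<noteq> {}" "hutchinson C G \<subseteq> G"
  shows "F \<subseteq> G"
proof (cases "F = {}")
  case False
  then obtain x where x: "x \<in> F" "\<forall>z\<in>F. infdist z G \<le> infdist x G"
    using continuous_attains_sup[OF F(2) _ continuous_on_infdist[OF continuous_on_id]] by blast
  have "infdist x G = 0"
  proof (cases "x \<in> C")
    case True
    then have "x \<in> G"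
      using G(4) unfolding hutchinson_def by blast
    then show ?thesis by simp
  next
    case False
    then obtain i y where i: "i \<in> {1..N}" and y: "y \<in> F" "x = S i y"
      using F(3) x(1) unfolding hutchinson_def by blast
    have r: "0 < r i" "r i < 1"
      using ratio[OF i] by auto
    have "infdist x G / r i \<le> infdist y G"
      unfolding infdist_notempty[OF G(3), of y]
    proof (rule cINF_greatest[OF G(3)])
      fix g assume g: "g \<in> G"
      then have "S i g \<in> G"
        using i G(4) unfolding hutchinson_def by blast
      then have "infdist x G \<le> dist (S i y) (S i g)"
        unfolding y(2) by (rule infdist_le)
      also have "\<dots> = r i * dist y g"
        using similarity[OF i] y(1) g F(1) G(1) unfolding similarity_on_def by blast
      finally show "infdist x G / r i \<le> dist y g"
        using r by (simp add: field_simps)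
    qed
    also have "\<dots> \<le> infdist x G"
      using x(2) y(1) by blast
    finally have "infdist x G * (1 - r i) \<le> 0"
      using r by (simp add: field_simps)
    then show ?thesis
      using r infdist_nonneg[of x G] by (simp add: mult_le_0_iff)
  qed
  then have "infdist z G = 0" if "z \<in> F" for z
    using x(2) that infdist_nonneg[of z G] by force
  then show ?thesis
    using in_closed_iff_infdist_zero[of G] G(2,3) compact_imp_closed by blast
qed simp

text \<open>The iterates of \<open>X\<close> are compact and decrease to a nonempty set \<open>F\<close>. A point of \<open>F\<close> outside \<open>C\<close> lies
  in the image under \<open>S i\<close> of every iterate for one and the same \<open>i\<close>, because the iterates decrease and there are finitely many
  indices; by injectivity its preimages under \<open>S i\<close> coincide, so the preimage lies in \<open>F\<close>.\<close>

lemma hutchinson_fixed_point_exists: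
  assumes C: "C \<subseteq> X" "compact C"
  shows "\<exists>F. F \<subseteq> X \<and> F \<noteq> {} \<and> compact F \<and> F = hutchinson C F"
proof -
  define K where "K n = (hutchinson C ^^ n) X" for n
  have K_Suc: "K (Suc n) = hutchinson C (K n)" for n
    by (simp add: K_def)
  have K: "K n \<subseteq> X \<and> compact (K n) \<and> K n \<noteq> {}" for n
  proof (induction n)
    case 0
    then show ?case using compact_X X_nonempty by (simp add: K_def)
  next
    case (Suc n)
    moreover have "hutchinson C (K n) \<noteq> {}"
      using Suc N_pos unfolding hutchinson_def by auto
    ultimately show ?case
      unfolding K_Suc using hutchinson_subset hutchinson_compact C by blast
  qed
  have "K (Suc n) \<subseteq> K n" for n
  proof (induction n)
    case 0
    then show ?case using K[of 1] by (simp add: K_def)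
  next
    case (Suc n)
    then show ?case using hutchinson_mono K_Suc by blast
  qed
  then have K_anti: "K n \<subseteq> K m" if "m \<le> n" for m n
    using that by (rule lift_Suc_antimono_le)
  define F where "F = (\<Inter>n. K n)"
  have "F \<subseteq> X"
    using K unfolding F_def by blast
  have "compact (X \<inter> F)"
    unfolding F_def using K compact_imp_closed by (intro compact_Int_closed compact_X closed_INT) auto
  then have "compact F"
    using \<open>F \<subseteq> X\<close> by (simp add: Int_absorb1)
  have "X \<inter> (\<Inter>n. K n) \<noteq> {}"
  proof (rule compact_imp_fip_image[OF compact_X])
    show "closed (K n)" for n
      using K compact_imp_closed by blast
    fix I :: "nat set" assume "finite I"
    then have "K (Max (insert 0 I)) \<subseteq> K n" if "n \<in> I" for n
      using that by (intro K_anti) auto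
    then have "K (Max (insert 0 I)) \<subseteq> X \<inter> (\<Inter>n\<in>I. K n)"
      using K by blast
    then show "X \<inter> (\<Inter>n\<in>I. K n) \<noteq> {}"
      using K by blast
  qed
  then have "F \<noteq> {}"
    unfolding F_def by blast
  have "hutchinson C F \<subseteq> K n" for n
  proof (cases n)
    case 0
    then show ?thesis
      using hutchinson_subset[OF \<open>F \<subseteq> X\<close> C(1)] by (simp add: K_def)
  next
    case (Suc m)
    then show ?thesis
      unfolding Suc K_Suc by (intro hutchinson_mono) (auto simp: F_def)
  qed
  then have "hutchinson C F \<subseteq> F"
    unfolding F_def by blast
  moreover have "F \<subseteq> hutchinson C F"
  proof
    fix x assume x: "x \<in> F"
    show "x \<in> hutchinson C F"
    proof (cases "x \<in> C")
      case True
      then show ?thesis by (simp add: hutchinson_def)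
    next
      case False
      have "\<exists>i\<in>{1..N}. \<forall>n. x \<in> S i ` K n"
      proof (rule ccontr)
        assume "\<not> (\<exists>i\<in>{1..N}. \<forall>n. x \<in> S i ` K n)"
        then obtain n where n: "\<And>i. i \<in> {1..N} \<Longrightarrow> x \<notin> S i ` K (n i)"
          by metis
        have "x \<notin> S i ` K (Max (n ` {1..N}))" if "i \<in> {1..N}" for i
          using n[OF that] K_anti[of "n i" "Max (n ` {1..N})"] that by auto
        then have "x \<notin> K (Suc (Max (n ` {1..N})))"
          using False unfolding K_Suc hutchinson_def by blast
        then show False
          using x unfolding F_def by blast
      qed
      then obtain i where i: "i \<in> {1..N}" and img: "\<And>n. x \<in> S i ` K n"
        by blast
      obtain y where y: "y \<in> K 0" "x = S i y"
        using img by blast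
      have "y \<in> K n" for n
      proof -
        obtain z where "z \<in> K n" "x = S i z"
          using img by blast
        then show ?thesis
          using similarity_on_inj[OF similarity[OF i]] y K unfolding inj_on_def by blast
      qed
      then show ?thesis
        using i y(2) unfolding F_def hutchinson_def by blast
    qed
  qed
  ultimately show ?thesis
    using \<open>F \<subseteq> X\<close> \<open>compact F\<close> \<open>F \<noteq> {}\<close> by blast
qed

lemma hutchinson_fixed_point_ex1:
  assumes C: "C \<subseteq> X" "compact C"
  shows "\<exists>!F. F \<subseteq> X \<and> F \<noteq> {} \<and> compact F \<and> F = hutchinson C F"
proof (rule ex_ex1I)
  fix F G
  assume "F \<subseteq> X \<and> F \<noteq> {} \<and> compact F \<and> F = hutchinson C F"
    and "G \<subseteq> X \<and> G \<noteq> {} \<and> compact G \<and> G = hutchinson C G"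
  then show "F = G"
    using hutchinson_comparison[of F C G] hutchinson_comparison[of G C F] by auto
qed (rule hutchinson_fixed_point_exists[OF C])

abbreviation F\<^sub>0 :: "'a set" where
  "F\<^sub>0 \<equiv> homogeneous_attractor X N S"

abbreviation F\<^sub>C :: "'a set \<Rightarrow> 'a set" where
  "F\<^sub>C C \<equiv> inhomogeneous_attractor X N S C"

lemma inhomogeneous_attractor:
  assumes C: "C \<subseteq> X" "compact C"
  shows "F\<^sub>C C \<subseteq> X" "F\<^sub>C C \<noteq> {}" "compact (F\<^sub>C C)" "hutchinson C (F\<^sub>C C) = F\<^sub>C C"
proof -
  have "F\<^sub>C C \<subseteq> X \<and> F\<^sub>C C \<noteq> {} \<and> compact (F\<^sub>C C) \<and> F\<^sub>C C = hutchinson C (F\<^sub>C C)"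
    using theI'[OF hutchinson_fixed_point_ex1[OF C]]
    unfolding inhomogeneous_attractor_def hutchinson_def .
  then show "F\<^sub>C C \<subseteq> X" "F\<^sub>C C \<noteq> {}" "compact (F\<^sub>C C)" "hutchinson C (F\<^sub>C C) = F\<^sub>C C"
    by blast+
qed

lemma homogeneous_attractor:
  shows "F\<^sub>0 \<subseteq> X" "F\<^sub>0 \<noteq> {}" "compact F\<^sub>0" "hutchinson {} F\<^sub>0 = F\<^sub>0"
proof -
  have "F\<^sub>0 = F\<^sub>C {}"
    unfolding homogeneous_attractor_def inhomogeneous_attractor_def by simp
  then show "F\<^sub>0 \<subseteq> X" "F\<^sub>0 \<noteq> {}" "compact F\<^sub>0" "hutchinson {} F\<^sub>0 = F\<^sub>0"
    using inhomogeneous_attractor[of "{}"] by simp_all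
qed

lemma homogeneous_subset_inhomogeneous:
  assumes C: "C \<subseteq> X" "compact C"
  shows "F\<^sub>0 \<subseteq> F\<^sub>C C"
proof (rule hutchinson_comparison[of _ "{}"])
  show "hutchinson {} (F\<^sub>C C) \<subseteq> F\<^sub>C C"
    using inhomogeneous_attractor(4)[OF C] unfolding hutchinson_def by blast
qed (use homogeneous_attractor inhomogeneous_attractor[OF C] in auto)

lemma condensation_subset_inhomogeneous:
  "C \<subseteq> X \<Longrightarrow> compact C \<Longrightarrow> C \<subseteq> F\<^sub>C C"
  using inhomogeneous_attractor(4) unfolding hutchinson_def by blast

section \<open>The similarity dimension\<close>

text \<open>The left-hand side of Moran's equation, whose root is the similarity dimension.\<close>

definition moran_sum :: "real \<Rightarrow> real" where
  "moran_sum t = (\<Sum>i=1..N. r i powr t)"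

lemma moran_sum_strict_antimono:
  assumes "t < u"
  shows "moran_sum u < moran_sum t"
  unfolding moran_sum_def
proof (rule sum_strict_mono)
  show "r i powr u < r i powr t" if "i \<in> {1..N}" for i
    using ratio[OF that] assms by (simp add: powr_def mult_strict_right_mono_neg)
qed (use N_pos in auto)

text \<open>The sum is at least \<open>1\<close> at \<open>0\<close> and falls to at most \<open>1\<close> at large arguments, which gives a root;
  strict monotonicity makes it the only one, so that the definite description denotes it.\<close>

lemma moran_sum_similarity_dim: "moran_sum (similarity_dim N r) = 1"
proof -
  obtain p q where q: "0 < q" "q < 1" "\<And>i. i \<in> {1..N} \<Longrightarrow> p \<le> r i \<and> r i \<le> q"
    using finite_ratio_bounds[of "{1..N}" r] ratio by (metis finite_atLeastAtMost)
  obtain n where "q ^ n < 1 / real N"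
    using real_arch_pow_inv[of "1 / real N" q] q N_pos by auto
  have "moran_sum (real n) = (\<Sum>i=1..N. r i ^ n)"
    unfolding moran_sum_def by (intro sum.cong refl powr_realpow) (use ratio in auto)
  also have "\<dots> \<le> (\<Sum>i=1..N. q ^ n)"
    using q(3) ratio by (intro sum_mono power_mono) (auto simp: less_imp_le)
  also have "\<dots> \<le> 1"
    using \<open>q ^ n < 1 / real N\<close> N_pos by (simp add: field_simps)
  finally have "moran_sum (real n) \<le> 1" .
  moreover have "1 \<le> moran_sum 0"
  proof -
    have "moran_sum 0 = (\<Sum>i=1..N. 1)"
      unfolding moran_sum_def by (intro sum.cong refl) (use ratio in force)
    then show ?thesis using N_pos by simp
  qed
  moreover have "continuous_on {0..real n} moran_sum"
    unfolding moran_sum_def by (intro continuous_intros) (use ratio in force)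
  ultimately obtain s where s: "moran_sum s = 1"
    using IVT2'[of moran_sum "real n" 1 0] by auto
  have "similarity_dim N r = s"
    unfolding similarity_dim_def moran_sum_def[symmetric]
  proof (rule the_equality)
    show "moran_sum s = 1"
      by (rule s)
  next
    fix u assume "moran_sum u = 1"
    then show "u = s"
      using s moran_sum_strict_antimono[of u s] moran_sum_strict_antimono[of s u] by linarith
  qed
  then show ?thesis using s by simp
qed

lemma similarity_dim_nonneg: "0 \<le> similarity_dim N r"
proof (rule ccontr)
  assume "\<not> 0 \<le> similarity_dim N r"
  then have "moran_sum 0 < 1"
    using moran_sum_strict_antimono[of "similarity_dim N r" 0] moran_sum_similarity_dim by simp
  moreover have "moran_sum 0 = (\<Sum>i=1..N. 1)"
    unfolding moran_sum_def by (intro sum.cong refl) (use ratio in force)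
  ultimately show False
    using N_pos by simp
qed

section \<open>The upper bound\<close>

text \<open>Covering \<open>S i ` F\<close> at scale \<open>\<delta>\<close> amounts to covering \<open>F\<close> at the larger scale \<open>\<delta> / r i\<close>, so
  \<open>N\<^sub>\<delta>(F) \<le> (\<Sum>i. N\<^bsub>\<delta>/r i\<^esub>(F)) + N\<^sub>\<delta>(C)\<close>. Inserting the bound \<open>M * \<delta> powr - t\<close> on the right returns
  \<open>(M * moran_sum t + K) * \<delta> powr - t\<close>, and since \<open>moran_sum t < 1\<close> this does not exceed
  \<open>M * \<delta> powr - t\<close> once \<open>M \<ge> K / (1 - moran_sum t)\<close>.\<close>

lemma covering_number_power_law:
  assumes F: "F \<subseteq> X" "F \<subseteq> hutchinson C F" and C: "C \<subseteq> X"
    and t: "0 \<le> t" "moran_sum t < 1"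
    and K: "\<And>\<delta>. 0 < \<delta> \<Longrightarrow> \<delta> \<le> 1 \<Longrightarrow> real (covering_number \<delta> C) \<le> K * \<delta> powr - t"
  obtains M where "\<And>\<delta>. 0 < \<delta> \<Longrightarrow> \<delta> \<le> 1 \<Longrightarrow> real (covering_number \<delta> F) \<le> M * \<delta> powr - t"
proof -
  obtain p q where pq: "0 < p" "0 < q" "q < 1" "\<And>i. i \<in> {1..N} \<Longrightarrow> p \<le> r i \<and> r i \<le> q"
    using finite_ratio_bounds[of "{1..N}" r] ratio by (metis finite_atLeastAtMost)
  have "p \<le> 1"
    using pq(4)[of 1] pq(3) N_pos by simp
  \<comment> \<open>The first term settles the scales in \<open>{1..1 / p}\<close>, the second one the recursion below \<open>1\<close>.\<close>
  define M where "M = max (real (covering_number 1 F) * (1 / p) powr t) (K / (1 - moran_sum t))"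
  have M_K: "M * moran_sum t + K \<le> M"
  proof -
    have "K / (1 - moran_sum t) \<le> M"
      unfolding M_def by simp
    then show ?thesis
      using t(2) by (simp add: field_simps)
  qed
  \<comment> \<open>The range reaches up to \<open>1 / p\<close> because \<open>\<delta> / r i\<close> can be this large when \<open>\<delta> < 1\<close>.\<close>
  have "real (covering_number \<delta> F) \<le> M * \<delta> powr - t" if \<delta>: "0 < \<delta>" "\<delta> \<le> 1 / p" for \<delta>
    using pq(2,3) zero_less_one _ _ \<delta>
  proof (rule scale_induct)
    fix \<delta> :: real assume \<delta>: "1 \<le> \<delta>" "\<delta> \<le> 1 / p"
    have "real (covering_number \<delta> F) \<le> real (covering_number 1 F)"
      using covering_number_mono[OF compact_X F(1) order_refl zero_less_one \<delta>(1)] by simp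
    also have "\<dots> = real (covering_number 1 F) * (1 / p) powr t * (1 / p) powr - t"
      using pq(1) by (simp add: powr_minus)
    also have "\<dots> \<le> M * (1 / p) powr - t"
      unfolding M_def by (intro mult_right_mono) auto
    also have "\<dots> \<le> M * \<delta> powr - t"
    proof (rule mult_left_mono)
      show "(1 / p) powr - t \<le> \<delta> powr - t"
        using \<delta> t(1) by (intro powr_mono2') auto
      have "0 \<le> real (covering_number 1 F) * (1 / p) powr t"
        by simp
      then show "0 \<le> M"
        unfolding M_def by linarith
    qed
    finally show "real (covering_number \<delta> F) \<le> M * \<delta> powr - t" .
  next
    fix \<delta> :: real assume \<delta>: "0 < \<delta>" "\<delta> < 1"
      and IH: "\<And>\<eta>. \<delta> / q \<le> \<eta> \<Longrightarrow> \<eta> \<le> 1 / p \<Longrightarrow> real (covering_number \<eta> F) \<le> M * \<eta> powr - t"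
    have "covering_number \<delta> F \<le> covering_number \<delta> (hutchinson C F)"
      using covering_number_mono[OF compact_X hutchinson_subset[OF F(1) C] F(2) \<delta>(1)] by simp
    also have "\<dots> \<le> covering_number \<delta> (\<Union>i\<in>{1..N}. S i ` F) + covering_number \<delta> C"
      unfolding hutchinson_def
      using maps_into F(1) C \<delta>(1) by (intro covering_number_Un_le[OF compact_X] UN_least) auto
    also have "covering_number \<delta> (\<Union>i\<in>{1..N}. S i ` F) \<le> (\<Sum>i=1..N. covering_number \<delta> (S i ` F))"
      using maps_into F(1) \<delta>(1) by (intro covering_number_UN_le[OF compact_X]) auto
    also have "\<dots> = (\<Sum>i=1..N. covering_number (\<delta> / r i) F)"
      using covering_number_similarity_image[OF compact_X similarity F(1) \<delta>(1)]
      by (intro sum.cong) auto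
    finally have "real (covering_number \<delta> F)
        \<le> (\<Sum>i=1..N. real (covering_number (\<delta> / r i) F)) + real (covering_number \<delta> C)"
      unfolding of_nat_sum[symmetric] of_nat_add[symmetric] of_nat_le_iff by simp
    also have "\<dots> \<le> (\<Sum>i=1..N. M * (\<delta> / r i) powr - t) + K * \<delta> powr - t"
    proof (rule add_mono[OF sum_mono K])
      show "real (covering_number (\<delta> / r i) F) \<le> M * (\<delta> / r i) powr - t" if i: "i \<in> {1..N}" for i
      proof (rule IH)
        show "\<delta> / q \<le> \<delta> / r i"
          using ratio[OF i] pq(4)[OF i] \<delta> by (intro divide_left_mono) auto
        show "\<delta> / r i \<le> 1 / p"
          using pq(1) pq(4)[OF i] \<delta> by (intro frac_le) auto
      qed
    qed (use \<delta> in auto)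
    also have "(\<Sum>i=1..N. M * (\<delta> / r i) powr - t) = (\<Sum>i=1..N. M * \<delta> powr - t * r i powr t)"
      using ratio \<delta> by (intro sum.cong) (auto simp: powr_divide powr_minus field_simps)
    also have "\<dots> = M * \<delta> powr - t * moran_sum t"
      unfolding moran_sum_def sum_distrib_left ..
    also have "M * \<delta> powr - t * moran_sum t + K * \<delta> powr - t = (M * moran_sum t + K) * \<delta> powr - t"
      by (simp add: algebra_simps)
    also have "\<dots> \<le> M * \<delta> powr - t"
      using M_K by (intro mult_right_mono) auto
    finally show "real (covering_number \<delta> F) \<le> M * \<delta> powr - t" .
  qed
  moreover have "1 \<le> 1 / p"
    using pq(1) \<open>p \<le> 1\<close> by simp
  ultimately show ?thesis
    by (intro that[of M]) (meson order_trans)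
qed

lemma upper_box_dim_homogeneous_le: "upper_box_dim F\<^sub>0 \<le> ereal (similarity_dim N r)"
proof (rule dense_ge)
  fix u assume u: "ereal (similarity_dim N r) < u"
  show "upper_box_dim F\<^sub>0 \<le> u"
  proof (cases u)
    case (real t)
    then have t: "similarity_dim N r < t"
      using u by simp
    then have "moran_sum t < 1"
      using moran_sum_strict_antimono moran_sum_similarity_dim by metis
    moreover have "0 \<le> t"
      using t similarity_dim_nonneg by simp
    moreover have "F\<^sub>0 \<subseteq> hutchinson {} F\<^sub>0"
      using homogeneous_attractor(4) by simp
    ultimately obtain M where
      "\<And>\<delta>. 0 < \<delta> \<Longrightarrow> \<delta> \<le> 1 \<Longrightarrow> real (covering_number \<delta> F\<^sub>0) \<le> M * \<delta> powr - t"
      using covering_number_power_law[of "F\<^sub>0" "{}" t 0] homogeneous_attractor(1)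
      by (auto simp: covering_number_empty)
    then show ?thesis
      unfolding real
      using upper_box_dim_le_of_power_law[OF compact_X homogeneous_attractor(1,2) zero_less_one]
      by blast
  qed (use u in auto)
qed

lemma upper_box_dim_inhomogeneous_le:
  assumes C: "C \<subseteq> X" "compact C" "C \<noteq> {}"
  shows "upper_box_dim (F\<^sub>C C) \<le> max (ereal (similarity_dim N r)) (upper_box_dim C)"
proof (rule dense_ge)
  note FC = inhomogeneous_attractor[OF C(1,2)]
  fix u assume u: "max (ereal (similarity_dim N r)) (upper_box_dim C) < u"
  show "upper_box_dim (F\<^sub>C C) \<le> u"
  proof (cases u)
    case (real t)
    then have t: "similarity_dim N r < t" "upper_box_dim C < ereal t"
      using u by auto
    then have p: "moran_sum t < 1"
      using moran_sum_strict_antimono moran_sum_similarity_dim by metis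
    have "0 \<le> t"
      using t similarity_dim_nonneg by simp
    obtain K where
      "\<And>\<delta>. 0 < \<delta> \<Longrightarrow> \<delta> \<le> 1 \<Longrightarrow> real (covering_number \<delta> C) \<le> K * \<delta> powr - t"
      using power_law_of_upper_box_dim_less[OF compact_X C(1,3) t(2) \<open>0 \<le> t\<close>] by blast
    moreover have "F\<^sub>C C \<subseteq> hutchinson C (F\<^sub>C C)"
      using FC(4) by simp
    ultimately obtain M where
      "\<And>\<delta>. 0 < \<delta> \<Longrightarrow> \<delta> \<le> 1 \<Longrightarrow> real (covering_number \<delta> (F\<^sub>C C)) \<le> M * \<delta> powr - t"
      using covering_number_power_law[OF FC(1) _ C(1) \<open>0 \<le> t\<close> p] by blast
    then show ?thesis
      unfolding real
      using upper_box_dim_le_of_power_law[OF compact_X FC(1,2) zero_less_one] by blast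
  qed (use u in auto)
qed

section \<open>The lower bound under the strong open set condition\<close>

definition words :: "nat \<Rightarrow> nat list set" where
  "words n = {w. set w \<subseteq> {1..N} \<and> length w = n}"

fun word_map :: "nat list \<Rightarrow> 'a \<Rightarrow> 'a" where
  "word_map [] x = x"
| "word_map (i # w) x = S i (word_map w x)"

definition word_ratio :: "nat list \<Rightarrow> real" where
  "word_ratio w = prod_list (map r w)"

lemma word_map_append: "word_map (v @ w) x = word_map v (word_map w x)"
  by (induction v) auto

lemma word_ratio_append: "word_ratio (v @ w) = word_ratio v * word_ratio w"
  by (simp add: word_ratio_def)

lemma words_Suc: "words (Suc n) = (\<lambda>(w, i). i # w) ` (words n \<times> {1..N})"
  unfolding words_def by (rule lists_length_Suc_eq)

lemma finite_words: "finite (words n)"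
  unfolding words_def by (rule finite_lists_length_eq) simp

lemma word_similarity:
  "set w \<subseteq> {1..N} \<Longrightarrow> similarity_on X (word_map w) (word_ratio w)"
proof (induction w)
  case Nil
  then show ?case by (simp add: similarity_on_def word_ratio_def)
next
  case (Cons i w)
  then have "similarity_on X (S i) (r i)" "similarity_on X (word_map w) (word_ratio w)"
    using similarity by auto
  then show ?case
    unfolding similarity_on_def word_ratio_def by (auto simp: image_subset_iff)
qed

lemma word_map_preserves:
  assumes "\<And>i. i \<in> {1..N} \<Longrightarrow> S i ` E \<subseteq> E" "set w \<subseteq> {1..N}"
  shows "word_map w ` E \<subseteq> E"
  using assms(2) by (induction w) (use assms(1) in \<open>auto simp: image_subset_iff\<close>)

lemma word_map_homogeneous_subset: "set w \<subseteq> {1..N} \<Longrightarrow> word_map w ` F\<^sub>0 \<subseteq> F\<^sub>0"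
  using homogeneous_attractor(4) unfolding hutchinson_def
  by (intro word_map_preserves) blast

lemma word_ratio_le_power:
  assumes "0 \<le> q" "\<And>i. i \<in> {1..N} \<Longrightarrow> r i \<le> q" "set w \<subseteq> {1..N}"
  shows "word_ratio w \<le> q ^ length w"
  using assms(3)
proof (induction w)
  case (Cons i w)
  then have "0 \<le> word_ratio w"
    using word_similarity[of w] unfolding similarity_on_def by simp
  then have "r i * word_ratio w \<le> q * q ^ length w"
    using Cons assms(1,2) by (intro mult_mono) auto
  then show ?case by (simp add: word_ratio_def)
qed (simp add: word_ratio_def)

lemma sum_word_ratio_powr: "(\<Sum>w\<in>words n. word_ratio w powr t) = moran_sum t ^ n"
proof (induction n)
  case 0
  have "words 0 = {[]}"
    by (auto simp: words_def)
  then show ?case by (simp add: word_ratio_def)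
next
  case (Suc n)
  have "(\<Sum>w\<in>words (Suc n). word_ratio w powr t)
      = (\<Sum>(w, i)\<in>words n \<times> {1..N}. word_ratio (i # w) powr t)"
    unfolding words_Suc by (subst sum.reindex) (auto simp: inj_on_def case_prod_beta)
  also have "\<dots> = (\<Sum>(w, i)\<in>words n \<times> {1..N}. word_ratio w powr t * r i powr t)"
  proof (intro sum.cong refl, clarify)
    fix w i assume "w \<in> words n" "i \<in> {1..N}"
    then show "word_ratio (i # w) powr t = word_ratio w powr t * r i powr t"
      by (simp add: word_ratio_def powr_mult)
  qed
  also have "\<dots> = (\<Sum>w\<in>words n. word_ratio w powr t) * moran_sum t"
    unfolding moran_sum_def sum_product sum.cartesian_product ..
  finally show ?case
    using Suc by simp
qed

lemma homogeneous_word_cover: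
  assumes "x \<in> F\<^sub>0"
  shows "\<exists>w\<in>words n. x \<in> word_map w ` F\<^sub>0"
  using assms
proof (induction n arbitrary: x)
  case 0
  then show ?case by (auto simp: words_def)
next
  case (Suc n)
  then obtain i y where i: "i \<in> {1..N}" and y: "y \<in> F\<^sub>0" "x = S i y"
    using homogeneous_attractor(4) unfolding hutchinson_def by blast
  with Suc.IH obtain w where "w \<in> words n" "y \<in> word_map w ` F\<^sub>0"
    by blast
  then have "i # w \<in> words (Suc n)" "x \<in> word_map (i # w) ` F\<^sub>0"
    using i y(2) by (auto simp: words_def)
  then show ?case by blast
qed

lemma homogeneous_small_copy:
  assumes U: "openin (top_of_set X) U" and "F\<^sub>0 \<inter> U \<noteq> {}"
  obtains w where "set w \<subseteq> {1..N}" "word_map w ` F\<^sub>0 \<subseteq> U"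
proof -
  obtain x where x: "x \<in> F\<^sub>0" "x \<in> U"
    using assms(2) by blast
  then obtain e where e: "0 < e" "\<And>y. y \<in> X \<Longrightarrow> dist y x < e \<Longrightarrow> y \<in> U"
    using U unfolding openin_euclidean_subtopology_iff by blast
  obtain D where D: "0 < D" "\<And>y z. y \<in> X \<Longrightarrow> z \<in> X \<Longrightarrow> dist y z \<le> D"
    using compact_imp_bounded[OF compact_X] unfolding bounded_two_points
    by (metis dist_commute less_max_iff_disj max.coboundedI1 max.cobounded2 zero_less_one)
  obtain p q where q: "0 < q" "q < 1" "\<And>i. i \<in> {1..N} \<Longrightarrow> p \<le> r i \<and> r i \<le> q"
    using finite_ratio_bounds[of "{1..N}" r] ratio by (metis finite_atLeastAtMost)
  obtain n where n: "q ^ n < e / D"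
    using real_arch_pow_inv[of "e / D" q] q e D by auto
  obtain w z where w: "w \<in> words n" and z: "z \<in> F\<^sub>0" "x = word_map w z"
    using homogeneous_word_cover[OF x(1)] by blast
  then have set_w: "set w \<subseteq> {1..N}" and len: "length w = n"
    by (auto simp: words_def)
  have sim: "similarity_on X (word_map w) (word_ratio w)"
    by (rule word_similarity[OF set_w])
  have "word_map w y \<in> U" if y: "y \<in> F\<^sub>0" for y
  proof (rule e(2))
    have X: "y \<in> X" "z \<in> X"
      using y z(1) homogeneous_attractor(1) by auto
    then show "word_map w y \<in> X"
      using sim unfolding similarity_on_def by blast
    have "dist (word_map w y) x = word_ratio w * dist y z"
      using sim X z(2) unfolding similarity_on_def by blast
    also have "\<dots> \<le> q ^ n * D"
      using word_ratio_le_power[of q w] q set_w len D X by (intro mult_mono) auto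
    also have "\<dots> < e"
      using n D(1) by (simp add: field_simps)
    finally show "dist (word_map w y) x < e" .
  qed
  then show ?thesis
    using that set_w by blast
qed

text \<open>Two distinct words of equal length first differ at some letter. Up to there the maps agree and are
  injective, at that letter the open set condition separates them, and the remaining letters keep
  the images inside \<open>U\<close>.\<close>

lemma word_images_disjoint:
  assumes U: "U \<subseteq> X" "\<And>i. i \<in> {1..N} \<Longrightarrow> S i ` U \<subseteq> U" "disjoint_family_on (\<lambda>i. S i ` U) {1..N}"
  shows "disjoint_family_on (\<lambda>v. word_map v ` U) (words n)"
proof (induction n)
  case 0
  then show ?case by (auto simp: words_def disjoint_family_on_def)
next
  case (Suc n)
  show ?case
    unfolding disjoint_family_on_def
  proof (intro ballI impI)
    fix v' w' assume "v' \<in> words (Suc n)" "w' \<in> words (Suc n)" and ne: "v' \<noteq> w'"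
    then obtain i j v w where v: "v' = i # v" "i \<in> {1..N}" "v \<in> words n"
      and w: "w' = j # w" "j \<in> {1..N}" "w \<in> words n"
      unfolding words_Suc by (elim imageE SigmaE) simp
    have sub: "word_map v ` U \<subseteq> U" "word_map w ` U \<subseteq> U"
      using v(3) w(3) word_map_preserves[of U, OF U(2)] unfolding words_def by blast+
    have img: "word_map v' ` U = S i ` word_map v ` U" "word_map w' ` U = S j ` word_map w ` U"
      unfolding v(1) w(1) by (auto simp: image_image)
    show "word_map v' ` U \<inter> word_map w' ` U = {}"
    proof (cases "i = j")
      case True
      then have "word_map v ` U \<inter> word_map w ` U = {}"
        using Suc v w ne unfolding disjoint_family_on_def by blast
      moreover have "S i ` (word_map v ` U) \<inter> S i ` (word_map w ` U)
          = S i ` (word_map v ` U \<inter> word_map w ` U)"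
        using similarity_on_inj[OF similarity[OF v(2)]] order_trans[OF sub(1) U(1)]
          order_trans[OF sub(2) U(1)]
        by (intro inj_on_image_Int[symmetric]) blast+
      ultimately show ?thesis
        unfolding img True by simp
    next
      case False
      then have "S i ` U \<inter> S j ` U = {}"
        using U(3) v(2) w(2) unfolding disjoint_family_on_def by blast
      then show ?thesis
        unfolding img using sub by blast
    qed
  qed
qed

text \<open>Some copy \<open>word_map w ` F\<^sub>0\<close> lies inside the open set \<open>U\<close>. Prefixing \<open>w\<close> with all words \<open>v\<close> of a
  fixed length \<open>k\<close> gives copies of \<open>F\<^sub>0\<close> inside the disjoint sets \<open>word_map v ` U\<close>. Their ratios satisfy
  \<open>(\<Sum>v. word_ratio (v @ w) powr t) = moran_sum t ^ k * word_ratio w powr t\<close>; for \<open>t\<close> below the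
  similarity dimension \<open>moran_sum t\<close> exceeds \<open>1\<close>, so for large \<open>k\<close> the price paid for the fixed suffix
  \<open>w\<close> is made up for.\<close>

lemma similarity_dim_le_lower_box_dim:
  assumes "strong_open_set_condition X N S"
  shows "ereal (similarity_dim N r) \<le> lower_box_dim F\<^sub>0"
proof (rule dense_le)
  obtain U where U: "openin (top_of_set X) U" "F\<^sub>0 \<inter> U \<noteq> {}" "\<And>i. i \<in> {1..N} \<Longrightarrow> S i ` U \<subseteq> U"
      "disjoint_family_on (\<lambda>i. S i ` U) {1..N}"
    using assms unfolding strong_open_set_condition_def by blast
  obtain w where w: "set w \<subseteq> {1..N}" "word_map w ` F\<^sub>0 \<subseteq> U"
    using homogeneous_small_copy[OF U(1,2)] .
  have nonneg: "0 \<le> lower_box_dim F\<^sub>0"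
    using lower_box_dim_nonneg[OF compact_X homogeneous_attractor(1,2)] .
  fix u assume u: "u < ereal (similarity_dim N r)"
  show "u \<le> lower_box_dim F\<^sub>0"
  proof (cases "u \<le> 0")
    case True
    then show ?thesis using nonneg by (rule order_trans)
  next
    case False
    then obtain t where t: "u = ereal t" "0 < t" "t < similarity_dim N r"
      using u by (cases u) auto
    have "1 < moran_sum t"
      using moran_sum_strict_antimono[OF t(3)] moran_sum_similarity_dim by simp
    have w_pos: "0 < word_ratio w"
      using word_similarity[OF w(1)] unfolding similarity_on_def by blast
    obtain k where k: "1 / word_ratio w powr t < moran_sum t ^ k"
      using real_arch_pow[OF \<open>1 < moran_sum t\<close>] by blast
    \<comment> \<open>Words of length \<open>Suc k\<close> rather than \<open>k\<close>: a nonempty prefix makes every ratio less than \<open>1\<close>.\<close>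
    have "1 / word_ratio w powr t \<le> moran_sum t ^ Suc k"
      using k power_increasing[of k "Suc k" "moran_sum t"] \<open>1 < moran_sum t\<close> by linarith
    then have k: "1 \<le> moran_sum t ^ Suc k * word_ratio w powr t"
      using w_pos by (simp only: pos_divide_le_eq powr_gt_zero)
    have "ereal t \<le> lower_box_dim F\<^sub>0"
    proof (rule le_lower_box_dim_of_disjoint_similar_copies[OF compact_X
          homogeneous_attractor(1,3,2) finite_words[of "Suc k"],
          where T = "\<lambda>v. word_map (v @ w)" and \<rho> = "\<lambda>v. word_ratio (v @ w)"])
      fix v assume v: "v \<in> words (Suc k)"
      then have set_vw: "set (v @ w) \<subseteq> {1..N}" and "v @ w \<noteq> []"
        using w(1) by (auto simp: words_def)
      obtain p q where q: "0 < q" "q < 1" "\<And>i. i \<in> {1..N} \<Longrightarrow> p \<le> r i \<and> r i \<le> q"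
        using finite_ratio_bounds[of "{1..N}" r] ratio by (metis finite_atLeastAtMost)
      have "word_ratio (v @ w) \<le> q ^ length (v @ w)"
        using q set_vw by (intro word_ratio_le_power) auto
      also have "\<dots> < 1"
        using q \<open>v @ w \<noteq> []\<close> by (subst power_less_one_iff) auto
      finally show "similarity_on X (word_map (v @ w)) (word_ratio (v @ w)) \<and>
          word_ratio (v @ w) < 1 \<and> word_map (v @ w) ` F\<^sub>0 \<subseteq> F\<^sub>0"
        using word_similarity[OF set_vw] word_map_homogeneous_subset[OF set_vw] by blast
    next
      have disj: "disjoint_family_on (\<lambda>v. word_map v ` U) (words (Suc k))"
        using word_images_disjoint[OF openin_imp_subset[OF U(1)] U(3,4)] by blast
      have sub: "word_map (v @ w) ` F\<^sub>0 \<subseteq> word_map v ` U" for v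
        using w(2) by (auto simp: word_map_append)
      show "disjoint_family_on (\<lambda>v. word_map (v @ w) ` F\<^sub>0) (words (Suc k))"
      proof (rule disjoint_family_on_bisimulation[OF disj])
        fix u v assume "word_map u ` U \<inter> word_map v ` U = {}"
        then show "word_map (u @ w) ` F\<^sub>0 \<inter> word_map (v @ w) ` F\<^sub>0 = {}"
          using sub[of u] sub[of v] by (meson disjoint_iff subset_iff)
      qed
    next
      have "(\<Sum>v\<in>words (Suc k). word_ratio (v @ w) powr t)
          = (\<Sum>v\<in>words (Suc k). word_ratio v powr t) * word_ratio w powr t"
        unfolding sum_distrib_right word_ratio_append by (simp add: powr_mult)
      then show "1 \<le> (\<Sum>v\<in>words (Suc k). word_ratio (v @ w) powr t)"
        using k by (simp add: sum_word_ratio_powr)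
    qed (use t(2) in simp)
    then show ?thesis using t(1) by simp
  qed
qed

end

section \<open>The box dimensions of the inhomogeneous attractor\<close>

lemma box_dim_eq:
  assumes "lower_box_dim E = d" "upper_box_dim E = d"
  shows "box_dim_exists E" "box_dim E = d"
  using assms unfolding box_dim_exists_def box_dim_def by auto

theorem corollary2p5:
  fixes X C F0 FC :: "'a::metric_space set"
    and N :: nat and S :: "nat \<Rightarrow> 'a \<Rightarrow> 'a" and r :: "nat \<Rightarrow> real" and s :: real
  assumes "compact X"
    and "similarity_ifs X N S r"
    and "s = similarity_dim N r"
    and "C \<subseteq> X" and "C \<noteq> {}" and "compact C"
    and "F0 = homogeneous_attractor X N S"
    and "FC = inhomogeneous_attractor X N S C"
  shows
    "(max (lower_box_dim F0) (lower_box_dim C) \<le> lower_box_dim FC \<and>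
      lower_box_dim FC \<le> upper_box_dim FC \<and>
      upper_box_dim FC \<le> max (ereal s) (upper_box_dim C)) \<and>
     (strong_open_set_condition X N S \<longrightarrow>
      max (lower_box_dim F0) (lower_box_dim C) \<le> lower_box_dim FC \<and>
      lower_box_dim FC \<le> upper_box_dim FC \<and>
      upper_box_dim FC \<le> max (lower_box_dim F0) (upper_box_dim C)) \<and>
     (box_dim_exists C \<and> box_dim C \<ge> ereal s \<longrightarrow>
      lower_box_dim FC = upper_box_dim FC \<and>
      upper_box_dim FC = box_dim C \<and>
      lower_box_dim FC = max (lower_box_dim F0) (lower_box_dim C)) \<and>
     (box_dim_exists C \<and> strong_open_set_condition X N S \<longrightarrow>
      box_dim_exists F0 \<and>
      lower_box_dim FC = upper_box_dim FC \<and>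
      upper_box_dim FC = max (box_dim F0) (box_dim C) \<and>
      lower_box_dim FC = max (lower_box_dim F0) (lower_box_dim C)) \<and>
     (strong_open_set_condition X N S \<and> upper_box_dim C \<le> ereal s \<longrightarrow>
      box_dim_exists F0 \<and>
      lower_box_dim FC = upper_box_dim FC \<and>
      upper_box_dim FC = ereal s \<and>
      ereal s = box_dim F0 \<and>
      lower_box_dim FC = max (lower_box_dim F0) (lower_box_dim C))"
proof -
  interpret similarity_system X N S r
    by unfold_locales (use assms in auto)
  have FC: "FC \<subseteq> X" "F0 \<subseteq> FC" "C \<subseteq> FC" "F0 \<noteq> {}"
    using inhomogeneous_attractor homogeneous_subset_inhomogeneous condensation_subset_inhomogeneous
      homogeneous_attractor assms by auto
  have lower: "max (lower_box_dim F0) (lower_box_dim C) \<le> lower_box_dim FC"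
    using lower_box_dim_mono[OF compact_X FC(1)] FC assms(5) by (intro max.boundedI) blast+
  have mid: "lower_box_dim FC \<le> upper_box_dim FC" "lower_box_dim C \<le> upper_box_dim C"
    by (rule lower_le_upper_box_dim)+
  have upper: "upper_box_dim FC \<le> max (ereal s) (upper_box_dim C)"
    using upper_box_dim_inhomogeneous_le assms by simp
  have F0: "lower_box_dim F0 \<le> ereal s"
    using order_trans[OF lower_le_upper_box_dim upper_box_dim_homogeneous_le] assms by simp
  have sosc: "lower_box_dim F0 = ereal s" "box_dim_exists F0" "box_dim F0 = ereal s"
    if "strong_open_set_condition X N S"
  proof -
    have "ereal s \<le> lower_box_dim F0" "upper_box_dim F0 \<le> ereal s"
      using similarity_dim_le_lower_box_dim[OF that] upper_box_dim_homogeneous_le assms by auto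
    then have "lower_box_dim F0 = ereal s" "upper_box_dim F0 = ereal s"
      using lower_le_upper_box_dim[of F0] by order+
    then show "lower_box_dim F0 = ereal s" "box_dim_exists F0" "box_dim F0 = ereal s"
      using box_dim_eq[of F0 "ereal s"] by simp_all
  qed
  have C: "lower_box_dim C = box_dim C" "upper_box_dim C = box_dim C" if "box_dim_exists C"
    using that box_dim_eq[OF refl, of C] unfolding box_dim_exists_def by auto
  have upper_sosc: "upper_box_dim FC \<le> max (lower_box_dim F0) (upper_box_dim C)"
    if "strong_open_set_condition X N S"
    using upper sosc(1)[OF that] by simp
  \<comment> \<open>Whenever the outer bounds coincide, all members of the chain are equal.\<close>
  have squeeze: "lower_box_dim FC = d \<and> upper_box_dim FC = d"
    if "max (lower_box_dim F0) (lower_box_dim C) = d" "max (ereal s) (upper_box_dim C) = d" for d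
    using lower mid(1) upper that by (metis order_antisym order_trans)
  have condensation_dominates: "lower_box_dim FC = upper_box_dim FC \<and> upper_box_dim FC = box_dim C \<and>
      lower_box_dim FC = max (lower_box_dim F0) (lower_box_dim C)"
    if "box_dim_exists C" "ereal s \<le> box_dim C"
  proof -
    have "max (lower_box_dim F0) (lower_box_dim C) = box_dim C"
      unfolding C(1)[OF that(1)] using order_trans[OF F0 that(2)] by (rule max_absorb2)
    moreover have "max (ereal s) (upper_box_dim C) = box_dim C"
      unfolding C(2)[OF that(1)] using that(2) by (rule max_absorb2)
    ultimately show ?thesis
      using squeeze by metis
  qed
  have both_box_dims_exist: "box_dim_exists F0 \<and> lower_box_dim FC = upper_box_dim FC \<and>
      upper_box_dim FC = max (box_dim F0) (box_dim C) \<and>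
      lower_box_dim FC = max (lower_box_dim F0) (lower_box_dim C)"
    if "box_dim_exists C" "strong_open_set_condition X N S"
    using squeeze[OF refl] sosc[OF that(2)] C[OF that(1)] by metis
  have homogeneous_dominates: "box_dim_exists F0 \<and> lower_box_dim FC = upper_box_dim FC \<and>
      upper_box_dim FC = ereal s \<and> ereal s = box_dim F0 \<and>
      lower_box_dim FC = max (lower_box_dim F0) (lower_box_dim C)"
    if "strong_open_set_condition X N S" "upper_box_dim C \<le> ereal s"
  proof -
    have "max (lower_box_dim F0) (lower_box_dim C) = ereal s"
      unfolding sosc(1)[OF that(1)] using order_trans[OF mid(2) that(2)] by (rule max_absorb1)
    moreover have "max (ereal s) (upper_box_dim C) = ereal s"
      using that(2) by (rule max_absorb1)
    ultimately show ?thesis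
      using squeeze sosc[OF that(1)] by metis
  qed
  show ?thesis
    using lower mid(1) upper upper_sosc condensation_dominates both_box_dims_exist homogeneous_dominates by blast
qed

end
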